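(* Let $m\ge1$ and let $\mathfrak g$ be a finite-dimensional complex Lie algebra with basis $\mathsf T^{\mathsf a}$ and structure constants $f^{\mathsf{abc}}$. For $\mathbf p=(p_1,\dots,p_{2m})\in\mathbb N_0^{2m}$, $P=\sum_{i=1}^{2m}p_i$ and $r\in\mathbb Z$, let $$S^{\mathsf a}[\mathbf p;r]=\mathsf T^{\mathsf a}\,\frac{(\mu^{1})^{p_1}(\mu^{2})^{p_2}\cdots(\mu^{2m})^{p_{2m}}}{\lambda_0^{P-r}\,\lambda_1^{r}} .$$ Then for all $\mathsf a,\mathsf b$, all $\mathbf p,\mathbf q\in\mathbb N_0^{2m}$ and all $r,s\in\mathbb Z$, $$\left[S^{\mathsf a}[\mathbf p;r],S^{\mathsf b}[\mathbf q;s]\right]=f^{\mathsf{abc}}\,S^{\mathsf c}[\mathbf p+\mathbf q;r+s]$$ (sum over $\mathsf c$), and the Lie algebra spanned by the modes $S^{\mathsf a}[\mathbf p;r]$ is isomorphic to $\mathcal L\mathfrak g[\mathbb C^{2m}]$, the loop algebra of the Lie algebra of polynomial maps $\mathbb C^{2m}\to\mathfrak g$.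
   Context: The variables are $\mu^{1},\dots,\mu^{2m}$ and $\lambda_0,\lambda_1$ (homogeneous coordinates on the twistor space $\{[\mu:\lambda]\in\mathbb{P}^{2m+1}:\lambda\neq0\}$, restricted to $\lambda_0\lambda_1\ne0$). The modes are $\mathfrak g$-valued functions, homogeneous of degree $0$. They are the modes of infinitesimal deformations of the holomorphically trivial bundle on twistor space (hyperholomorphic gauge perturbations of the flat connection on $\mathbb C^{4m}$). The bracket is the pointwise Lie bracket of $\mathfrak g$-valued functions, with $[\mathsf T^{\mathsf a},\mathsf T^{\mathsf b}]=f^{\mathsf{abc}}\mathsf T^{\mathsf c}$. $\mathfrak g[\mathbb C^{2m}]=\mathfrak g\otimes\mathbb C[\mu^1,\dots,\mu^{2m}]$ is the Lie algebra of polynomial maps with pointwise bracket. Its loop algebra is $\mathcal L\mathfrak g[\mathbb C^{2m}]=\mathfrak g[\mathbb C^{2m}]\otimes\mathbb C[\lambda,\lambda^{-1}]$ with bracket $[a\otimes\lambda^k,b\otimes\lambda^l]=[a,b]\otimes\lambda^{k+l}$. *)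

theory Defs
  imports "HOL-Analysis.Finite_Cartesian_Product" "HOL-Library.Function_Algebras"
begin

text \<open>
  A complex Lie algebra is given by a subspace \<open>carr L\<close> of an ambient complex vector space
  (a type of class \<open>ab_group_add\<close> with the scalar multiplication \<open>smul L\<close>) and a bracket
  \<open>brac L\<close>, which is only constrained on \<open>carr L\<close>.
\<close>

record 'v lie_struct =
  carr :: "'v set"
  smul :: "complex \<Rightarrow> 'v \<Rightarrow> 'v"
  brac :: "'v \<Rightarrow> 'v \<Rightarrow> 'v"

locale lie_algebra =
  fixes L :: "'v::ab_group_add lie_struct"
  assumes vs: "vector_space (smul L)"
    and carr_subspace: "module.subspace (smul L) (carr L)"
    and brac_closed: "x \<in> carr L \<Longrightarrow> y \<in> carr L \<Longrightarrow> brac L x y \<in> carr L"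
    and brac_add_left: "x \<in> carr L \<Longrightarrow> y \<in> carr L \<Longrightarrow> z \<in> carr L \<Longrightarrow>
          brac L (x + y) z = brac L x z + brac L y z"
    and brac_add_right: "x \<in> carr L \<Longrightarrow> y \<in> carr L \<Longrightarrow> z \<in> carr L \<Longrightarrow>
          brac L x (y + z) = brac L x y + brac L x z"
    and brac_smul_left: "x \<in> carr L \<Longrightarrow> y \<in> carr L \<Longrightarrow>
          brac L (smul L c x) y = smul L c (brac L x y)"
    and brac_smul_right: "x \<in> carr L \<Longrightarrow> y \<in> carr L \<Longrightarrow>
          brac L x (smul L c y) = smul L c (brac L x y)"
    and brac_self: "x \<in> carr L \<Longrightarrow> brac L x x = 0"
    and jacobi: "x \<in> carr L \<Longrightarrow> y \<in> carr L \<Longrightarrow> z \<in> carr L \<Longrightarrow>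
          brac L x (brac L y z) + brac L y (brac L z x) + brac L z (brac L x y) = 0"
begin

lemma zero_in_carr: "0 \<in> carr L"
  using carr_subspace vs module.subspace_0[of "smul L"] by (simp add: module_iff_vector_space)

lemma brac_zero_left: "y \<in> carr L \<Longrightarrow> brac L 0 y = 0"
  using brac_add_left[of 0 0 y] zero_in_carr by simp

lemma brac_zero_right: "y \<in> carr L \<Longrightarrow> brac L y 0 = 0"
  using brac_add_right[of y 0 0] zero_in_carr by simp

end

definition lie_isomorphism ::
  "'v::ab_group_add lie_struct \<Rightarrow> 'w::ab_group_add lie_struct \<Rightarrow> ('v \<Rightarrow> 'w) \<Rightarrow> bool" where
  "lie_isomorphism L M \<phi> \<longleftrightarrow>
     bij_betw \<phi> (carr L) (carr M) \<and>
     (\<forall>x\<in>carr L. \<forall>y\<in>carr L. \<phi> (x + y) = \<phi> x + \<phi> y) \<and>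
     (\<forall>c. \<forall>x\<in>carr L. \<phi> (smul L c x) = smul M c (\<phi> x)) \<and>
     (\<forall>x\<in>carr L. \<forall>y\<in>carr L. \<phi> (brac L x y) = brac M (\<phi> x) (\<phi> y))"

definition lie_isomorphic ::
  "'v::ab_group_add lie_struct \<Rightarrow> 'w::ab_group_add lie_struct \<Rightarrow> bool" where
  "lie_isomorphic L M \<longleftrightarrow> (\<exists>\<phi>. lie_isomorphism L M \<phi>)"

definition lie_basis :: "'g::ab_group_add lie_struct \<Rightarrow> 'a set \<Rightarrow> ('a \<Rightarrow> 'g) \<Rightarrow> bool" where
  "lie_basis G A T \<longleftrightarrow> inj_on T A \<and> \<not> module.dependent (smul G) (T ` A) \<and>
     module.span (smul G) (T ` A) = carr G"

definition pointwise_smul :: "'g lie_struct \<Rightarrow> complex \<Rightarrow> ('x \<Rightarrow> 'g) \<Rightarrow> 'x \<Rightarrow> 'g" where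
  "pointwise_smul G c F = (\<lambda>z. smul G c (F z))"

definition pointwise_brac :: "'g lie_struct \<Rightarrow> ('x \<Rightarrow> 'g) \<Rightarrow> ('x \<Rightarrow> 'g) \<Rightarrow> 'x \<Rightarrow> 'g" where
  "pointwise_brac G F H = (\<lambda>z. brac G (F z) (H z))"

definition pointwise_span ::
  "'g::ab_group_add lie_struct \<Rightarrow> ('x \<Rightarrow> 'g) set \<Rightarrow> ('x \<Rightarrow> 'g) lie_struct" where
  "pointwise_span G B =
     \<lparr> carr = module.span (pointwise_smul G) B,
       smul = pointwise_smul G,
       brac = pointwise_brac G \<rparr>"

definition monomial :: "nat ^ 'n \<Rightarrow> complex ^ 'n::finite \<Rightarrow> complex" where
  "monomial p \<mu> = (\<Prod>i\<in>UNIV. (\<mu> $ i) ^ (p $ i))"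

definition poly_map_algebra ::
  "'g::ab_group_add lie_struct \<Rightarrow> (complex ^ 'n::finite \<Rightarrow> 'g) lie_struct" where
  "poly_map_algebra G =
     pointwise_span G {(\<lambda>\<mu>. smul G (monomial p \<mu>) x) | p x. x \<in> carr G}"

text \<open>
  The powers of \<open>\<lambda>\<close> form a basis of the Laurent polynomials, so an element of the tensor
  product of \<open>L\<close> with them is a finite sum of terms \<open>F k \<otimes> \<lambda>\<^sup>k\<close>; it is represented by its
  finitely supported coefficient family \<open>F\<close>. The bracket is the bilinear extension of
  \<open>[a \<otimes> \<lambda>\<^sup>k, b \<otimes> \<lambda>\<^sup>l] = [a, b] \<otimes> \<lambda>\<^bsup>k+l\<^esup>\<close>, see \<open>loop_algebra_brac_tensor\<close>.
\<close>

definition loop_algebra :: "'v::ab_group_add lie_struct \<Rightarrow> (int \<Rightarrow> 'v) lie_struct" where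
  "loop_algebra L =
     \<lparr> carr = {F. finite {k. F k \<noteq> 0} \<and> (\<forall>k. F k \<in> carr L)},
       smul = (\<lambda>c F k. smul L c (F k)),
       brac = (\<lambda>F H n. \<Sum>k | F k \<noteq> 0. brac L (F k) (H (n - k))) \<rparr>"

definition loop_tensor :: "'v::zero \<Rightarrow> int \<Rightarrow> int \<Rightarrow> 'v" where
  "loop_tensor a k = (\<lambda>n. if n = k then a else 0)"

lemma (in lie_algebra) loop_algebra_brac_tensor:
  assumes "a \<in> carr L" "b \<in> carr L"
  shows "brac (loop_algebra L) (loop_tensor a k) (loop_tensor b l)
           = loop_tensor (brac L a b) (k + l)"
proof
  fix n
  have S: "{j. loop_tensor a k j \<noteq> 0} = (if a = 0 then {} else {k})"
    by (auto simp: loop_tensor_def)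
  show "brac (loop_algebra L) (loop_tensor a k) (loop_tensor b l) n
           = loop_tensor (brac L a b) (k + l) n"
    unfolding loop_algebra_def using assms
    by (auto simp: S) (auto simp: loop_tensor_def brac_zero_left brac_zero_right)
qed

lemma loop_algebra_carr_tensor_sum:
  assumes "F \<in> carr (loop_algebra L)"
  shows "F = (\<Sum>k | F k \<noteq> 0. loop_tensor (F k) k)"
proof
  fix n
  have fin: "finite {k. F k \<noteq> 0}" using assms by (simp add: loop_algebra_def)
  have "(\<Sum>k | F k \<noteq> 0. loop_tensor (F k) k) n = (\<Sum>k | F k \<noteq> 0. loop_tensor (F k) k n)"
    using fin by (induction rule: finite_induct) auto
  also have "\<dots> = F n" using fin by (simp add: loop_tensor_def sum.delta)
  finally show "F n = (\<Sum>k | F k \<noteq> 0. loop_tensor (F k) k) n" by simp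
qed

text \<open>
  A function on the region \<open>\<lambda>\<^sub>0 \<lambda>\<^sub>1 \<noteq> 0\<close> is represented by its extension by zero to all
  \<open>(\<mu>, \<lambda>\<^sub>0, \<lambda>\<^sub>1)\<close>. Without this convention the bracket relation would depend on the values of
  \<open>0 powi k\<close>. The exponent \<open>P - r\<close> is an integer and may be negative.
\<close>

definition mode ::
  "'g::ab_group_add lie_struct \<Rightarrow> 'g \<Rightarrow> nat ^ 'n::finite \<Rightarrow> int
     \<Rightarrow> (complex ^ 'n) \<times> complex \<times> complex \<Rightarrow> 'g" where
  "mode G t p r = (\<lambda>(\<mu>, l0, l1).
     if l0 \<noteq> 0 \<and> l1 \<noteq> 0
     then smul G (monomial p \<mu> / (l0 powi (int (\<Sum>i\<in>UNIV. p $ i) - r) * l1 powi r)) t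
     else 0)"

lemma mode_homogeneous:
  fixes p :: "nat ^ 'n::finite"
  assumes "c \<noteq> 0"
  shows "mode G t p r (\<chi> i. c * \<mu> $ i, c * l0, c * l1) = mode G t p r (\<mu>, l0, l1)"
proof -
  let ?P = "\<Sum>i\<in>UNIV. p $ i"
  have 1: "monomial p (\<chi> i. c * \<mu> $ i) = c ^ ?P * monomial p \<mu>"
    by (simp add: monomial_def power_mult_distrib prod.distrib power_sum)
  have 2: "c powi (int ?P - r) * c powi r = c ^ ?P"
  proof -
    have "c powi (int ?P - r) * c powi r = c powi int ?P"
      using assms power_int_add[of c "int ?P - r" r] by (simp del: of_nat_sum)
    then show ?thesis by (simp only: power_int_of_nat)
  qed
  have "monomial p (\<chi> i. c * \<mu> $ i) / ((c * l0) powi (int ?P - r) * (c * l1) powi r)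
      = (c ^ ?P * monomial p \<mu>) / (c ^ ?P * (l0 powi (int ?P - r) * l1 powi r))"
    unfolding 1 power_int_mult_distrib 2[symmetric] by (simp add: mult_ac)
  also have "\<dots> = monomial p \<mu> / (l0 powi (int ?P - r) * l1 powi r)"
    using assms by simp
  finally show ?thesis using assms by (simp add: mode_def)
qed

definition mode_algebra ::
  "'g::ab_group_add lie_struct \<Rightarrow> 'a set \<Rightarrow> ('a \<Rightarrow> 'g)
     \<Rightarrow> ((complex ^ 'n::finite) \<times> complex \<times> complex \<Rightarrow> 'g) lie_struct" where
  "mode_algebra G A T = pointwise_span G {mode G (T a) p r | a p r. a \<in> A}"

end

theory Submission imports Defs begin

text \<open>
  In the affine coordinates \<open>\<nu> = \<mu> / \<lambda>\<^sub>0\<close> and \<open>t = \<lambda>\<^sub>0 / \<lambda>\<^sub>1\<close> a mode is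
  \<open>\<nu>\<^bsup>p\<^esup> t\<^bsup>r\<^esup> T\<^sup>a\<close>. Hence \<open>F \<mapsto> \<Sum>\<^sub>k t\<^bsup>k\<^esup> F\<^sub>k(\<nu>)\<close> maps the loop algebra onto the span of
  the modes and respects the brackets. It is injective because a Laurent polynomial with vector
  coefficients that vanishes at all \<open>t \<noteq> 0\<close> has zero coefficients.
\<close>

section \<open>Vanishing Laurent polynomials with vector coefficients\<close>

lemma sum_fun_apply: "(\<Sum>i\<in>I. f i) x = (\<Sum>i\<in>I. f i x)"
  for f :: "'i \<Rightarrow> 'x \<Rightarrow> 'v::comm_monoid_add"
  by (induction I rule: infinite_finite_induct) auto

text \<open>Guarantees that the factors \<open>2 powi i - 2 powi j\<close> in the elimination below
  are nonzero. For either sign of \<open>k\<close> the equation reduces to \<open>2 ^ n = 1\<close>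
  in the natural numbers.\<close>

lemma complex_two_powi_eq_1: "(2 :: complex) powi k = 1 \<Longrightarrow> k = 0"
proof (cases k rule: int_cases2)
  case (nonneg n)
  assume "(2 :: complex) powi k = 1"
  then have "(of_nat (2 ^ n) :: complex) = of_nat 1"
    by (simp add: nonneg)
  then show ?thesis unfolding of_nat_eq_iff by (simp add: nonneg)
next
  case (nonpos n)
  assume "(2 :: complex) powi k = 1"
  then have "(of_nat (2 ^ n) :: complex) = of_nat 1"
    by (simp add: nonpos power_int_minus)
  then show ?thesis unfolding of_nat_eq_iff by (simp add: nonpos)
qed

text \<open>Replacing \<open>t\<close> by \<open>2 * t\<close> multiplies the term of degree
  \<open>k\<close> by \<open>2 powi k\<close>, so the degrees are told apart by distinct eigenvalues
  and can be eliminated one at a time. This works in any complex vector space.\<close>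

lemma laurent_coefficients_zero:
  fixes v :: "int \<Rightarrow> 'v::ab_group_add" and scale :: "complex \<Rightarrow> 'v \<Rightarrow> 'v"
  assumes "vector_space scale"
    and "finite S"
    and "\<And>t. t \<noteq> 0 \<Longrightarrow> (\<Sum>k\<in>S. scale (t powi k) (v k)) = 0"
    and "k \<in> S"
  shows "v k = 0"
  using assms(2-4)
proof (induction S arbitrary: v k rule: finite_induct)
  case empty
  then show ?case by simp
next
  case (insert j S)
  interpret vector_space scale by fact
  define w where "w i = scale (2 powi i - 2 powi j) (v i)" for i
  \<comment> \<open>With \<open>g(t)\<close> the given sum, \<open>g(2t) - 2\<^sup>j g(t)\<close> has no term of degree \<open>j\<close>.\<close>
  have w: "(\<Sum>i\<in>S. scale (t powi i) (w i)) = 0" if "t \<noteq> 0" for t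
  proof -
    have "0 = (\<Sum>i\<in>insert j S. scale ((2 * t) powi i) (v i))
             - scale (2 powi j) (\<Sum>i\<in>insert j S. scale (t powi i) (v i))"
      using insert.prems(1)[of t] insert.prems(1)[of "2 * t"] that by simp
    also have "\<dots> = (\<Sum>i\<in>insert j S. scale (t powi i) (w i))"
      unfolding scale_sum_right sum_subtractf[symmetric]
      by (intro sum.cong)
        (simp_all add: w_def power_int_mult_distrib algebra_simps)
    also have "\<dots> = (\<Sum>i\<in>S. scale (t powi i) (w i))"
      using insert.hyps by (simp add: w_def)
    finally show ?thesis by simp
  qed
  have S0: "v i = 0" if "i \<in> S" for i
  proof -
    \<comment> \<open>The induction hypothesis gives \<open>w i = 0\<close>; the scalar in
      \<open>w i\<close> is invertible because \<open>i\<close> and \<open>j\<close> differ.\<close>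
    have "i \<noteq> j" using that insert.hyps by auto
    then have "(2 :: complex) powi i \<noteq> 2 powi j"
      using complex_two_powi_eq_1[of "i - j"] by (auto simp: power_int_diff)
    moreover have "w i = 0" using insert.IH w that by blast
    ultimately show ?thesis by (simp add: w_def)
  qed
  \<comment> \<open>With all other coefficients zero, the sum at \<open>t = 1\<close> is just
    \<open>v j\<close>.\<close>
  have "v j = 0"
    using insert.prems(1)[of 1] insert.hyps S0 by simp
  then show ?case using S0 insert.prems by auto
qed

section \<open>Pointwise scaling, modes in affine coordinates, inverse isomorphisms\<close>

lemma vector_space_pointwise_smul:
  "vector_space (smul G) \<Longrightarrow> vector_space (pointwise_smul G)"
  by (simp add: vector_space_def pointwise_smul_def fun_eq_iff)

lemma monomial_add: "monomial (p + q) \<mu> = monomial p \<mu> * monomial q \<mu>"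
  by (simp add: monomial_def power_add prod.distrib)

text \<open>The monomial is homogeneous, so the part of the power of \<open>l0\<close> given by its
  total degree is absorbed into the coordinates \<open>\<mu> $ i / l0\<close>. In the resulting form
  the scalar is visibly multiplicative in \<open>p\<close> and in \<open>r\<close>.\<close>

lemma mode_affine:
  "mode G t p r (\<mu>, l0, l1) =
    (if l0 \<noteq> 0 \<and> l1 \<noteq> 0
     then smul G (monomial p (\<chi> i. \<mu> $ i / l0) * (l0 / l1) powi r) t else 0)"
proof (cases "l0 \<noteq> 0 \<and> l1 \<noteq> 0")
  case True
  have "monomial p (\<chi> i. \<mu> $ i / l0) = monomial p \<mu> / l0 ^ (\<Sum>i\<in>UNIV. p $ i)"
    by (simp add: monomial_def power_divide prod_dividef power_sum)
  moreover have "l0 powi (int (\<Sum>i\<in>UNIV. p $ i) - r) = l0 ^ (\<Sum>i\<in>UNIV. p $ i) / l0 powi r"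
    using True by (simp add: power_int_diff del: of_nat_sum)
  ultimately show ?thesis
    using True by (simp add: mode_def power_int_divide_distrib del: of_nat_sum)
qed (auto simp: mode_def)

text \<open>Allows an isomorphism to be constructed in the more convenient direction. A preimage is
  recognised by \<open>eq\<close> only if it lies in \<open>carr M\<close>, hence the closure
  assumptions on \<open>M\<close>.\<close>

lemma lie_isomorphic_inverse:
  assumes "lie_isomorphism M L \<psi>"
    and add: "\<And>x y. x \<in> carr M \<Longrightarrow> y \<in> carr M \<Longrightarrow> x + y \<in> carr M"
    and smul: "\<And>c x. x \<in> carr M \<Longrightarrow> smul M c x \<in> carr M"
    and brac: "\<And>x y. x \<in> carr M \<Longrightarrow> y \<in> carr M \<Longrightarrow> brac M x y \<in> carr M"
  shows "lie_isomorphic L M"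
proof -
  define \<phi> where "\<phi> = inv_into (carr M) \<psi>"
  have bij: "bij_betw \<psi> (carr M) (carr L)"
    using assms(1) by (simp add: lie_isomorphism_def)
  have \<phi>: "\<phi> y \<in> carr M" "\<psi> (\<phi> y) = y" if "y \<in> carr L" for y
    using bij that by (auto simp: \<phi>_def bij_betw_def inv_into_into f_inv_into_f)
  have eq: "\<phi> y = x" if "x \<in> carr M" "\<psi> x = y" for x y
    using bij that by (auto simp: \<phi>_def bij_betw_def)
  have "bij_betw \<phi> (carr L) (carr M)"
    unfolding \<phi>_def by (rule bij_betw_inv_into[OF bij])
  then have "lie_isomorphism L M \<phi>"
    using assms(1) \<phi> unfolding lie_isomorphism_def
    by (auto intro!: eq add smul brac)
  then show ?thesis by (auto simp: lie_isomorphic_def)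
qed

section \<open>Finite sums in a Lie algebra, and Lie algebras spanned by functions\<close>

context lie_algebra
begin

interpretation V: vector_space "smul L" by (rule vs)

lemma add_in_carr: "x \<in> carr L \<Longrightarrow> y \<in> carr L \<Longrightarrow> x + y \<in> carr L"
  by (rule V.subspace_add[OF carr_subspace])

lemma smul_in_carr: "x \<in> carr L \<Longrightarrow> smul L c x \<in> carr L"
  by (rule V.subspace_scale[OF carr_subspace])

lemma sum_in_carr: "(\<And>i. i \<in> I \<Longrightarrow> x i \<in> carr L) \<Longrightarrow> (\<Sum>i\<in>I. x i) \<in> carr L"
  by (rule V.subspace_sum[OF carr_subspace])

lemma brac_sum_left:
  assumes "\<And>i. i \<in> I \<Longrightarrow> x i \<in> carr L" "y \<in> carr L"
  shows "brac L (\<Sum>i\<in>I. x i) y = (\<Sum>i\<in>I. brac L (x i) y)"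
  using assms
  by (induction I rule: infinite_finite_induct)
    (simp_all add: brac_zero_left brac_add_left sum_in_carr)

lemma brac_sum_right:
  assumes "\<And>i. i \<in> I \<Longrightarrow> x i \<in> carr L" "y \<in> carr L"
  shows "brac L y (\<Sum>i\<in>I. x i) = (\<Sum>i\<in>I. brac L y (x i))"
  using assms
  by (induction I rule: infinite_finite_induct)
    (simp_all add: brac_zero_right brac_add_right sum_in_carr)

lemma brac_smul_smul:
  assumes "x \<in> carr L" "y \<in> carr L"
  shows "brac L (smul L c x) (smul L d y) = smul L (c * d) (brac L x y)"
  using assms by (simp add: brac_smul_left brac_smul_right smul_in_carr mult.commute)

lemma subspace_values_in_carr:
  "module.subspace (pointwise_smul L) {F :: 'x \<Rightarrow> 'v. \<forall>z. F z \<in> carr L}"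
proof -
  interpret P: vector_space "pointwise_smul L :: complex \<Rightarrow> ('x \<Rightarrow> 'v) \<Rightarrow> _"
    by (rule vector_space_pointwise_smul[OF vs])
  show ?thesis
    by (simp add: P.subspace_def zero_in_carr add_in_carr smul_in_carr pointwise_smul_def)
qed

lemma pointwise_span_values:
  assumes "F \<in> carr (pointwise_span L B)" "\<And>F z. F \<in> B \<Longrightarrow> F z \<in> carr L"
  shows "F z \<in> carr L"
proof -
  interpret P: vector_space "pointwise_smul L :: complex \<Rightarrow> ('x \<Rightarrow> 'v) \<Rightarrow> _"
    by (rule vector_space_pointwise_smul[OF vs])
  have "P.span B \<subseteq> {F. \<forall>z. F z \<in> carr L}"
    using assms(2) by (intro P.span_minimal subspace_values_in_carr) auto
  then show ?thesis using assms(1) by (auto simp: pointwise_span_def)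
qed

text \<open>The Lie axioms hold value by value, since every function in the span takes values in
  \<open>carr L\<close>. Closure under the bracket follows from the generators by bilinearity, one
  argument at a time.\<close>

lemma lie_algebra_pointwise_span:
  fixes B :: "('x \<Rightarrow> 'v) set"
  assumes vals: "\<And>F z. F \<in> B \<Longrightarrow> F z \<in> carr L"
    and closed: "\<And>F H. F \<in> B \<Longrightarrow> H \<in> B \<Longrightarrow>
      pointwise_brac L F H \<in> module.span (pointwise_smul L) B"
  shows "lie_algebra (pointwise_span L B)"
proof -
  interpret P: vector_space "pointwise_smul L :: complex \<Rightarrow> ('x \<Rightarrow> 'v) \<Rightarrow> _"
    by (rule vector_space_pointwise_smul[OF vs])
  have val: "F z \<in> carr L" if "F \<in> P.span B" for F z
    using pointwise_span_values[of F B z] vals that by (simp add: pointwise_span_def)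
  have closed1: "pointwise_brac L F H \<in> P.span B" if "F \<in> P.span B" "H \<in> B" for F H
  proof -
    \<comment> \<open>The values are carried through the induction because \<open>brac L\<close> is
      additive only on \<open>carr L\<close>.\<close>
    have "(\<forall>z. F z \<in> carr L) \<and> pointwise_brac L F H \<in> P.span B"
      using that(1)
    proof (induction rule: P.span_induct_alt)
      case base
      have "pointwise_brac L 0 H = 0"
        using vals that(2) by (simp add: pointwise_brac_def fun_eq_iff brac_zero_left)
      then have "pointwise_brac L 0 H \<in> P.span B"
        by (simp only: P.span_zero)
      moreover have "(0 :: 'x \<Rightarrow> 'v) z \<in> carr L" for z
        by (simp add: zero_in_carr)
      ultimately show ?case by (intro conjI allI)
    next
      case (step c K F)
      have "pointwise_brac L (pointwise_smul L c K + F) H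
          = pointwise_smul L c (pointwise_brac L K H) + pointwise_brac L F H"
        using step vals that(2)
        by (simp add: pointwise_brac_def pointwise_smul_def fun_eq_iff brac_add_left
            brac_smul_left smul_in_carr)
      also have "\<dots> \<in> P.span B"
        using step closed[OF step(1) that(2)] by (intro P.span_add P.span_scale) auto
      finally have "pointwise_brac L (pointwise_smul L c K + F) H \<in> P.span B" .
      moreover have "(pointwise_smul L c K + F) z \<in> carr L" for z
        using step vals by (simp add: pointwise_smul_def add_in_carr smul_in_carr)
      ultimately show ?case by (intro conjI allI)
    qed
    then show ?thesis by simp
  qed
  \<comment> \<open>The same induction in the second argument; \<open>closed1\<close> settles the
    brackets with a generator.\<close>
  have closed2: "pointwise_brac L F H \<in> P.span B" if "F \<in> P.span B" "H \<in> P.span B" for F H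
  proof -
    have "(\<forall>z. H z \<in> carr L) \<and> pointwise_brac L F H \<in> P.span B"
      using that(2)
    proof (induction rule: P.span_induct_alt)
      case base
      have "pointwise_brac L F 0 = 0"
        using val[OF that(1)] by (simp add: pointwise_brac_def fun_eq_iff brac_zero_right)
      then have "pointwise_brac L F 0 \<in> P.span B"
        by (simp only: P.span_zero)
      moreover have "(0 :: 'x \<Rightarrow> 'v) z \<in> carr L" for z
        by (simp add: zero_in_carr)
      ultimately show ?case by (intro conjI allI)
    next
      case (step c K H)
      have "pointwise_brac L F (pointwise_smul L c K + H)
          = pointwise_smul L c (pointwise_brac L F K) + pointwise_brac L F H"
        using step vals val[OF that(1)]
        by (simp add: pointwise_brac_def pointwise_smul_def fun_eq_iff brac_add_right
            brac_smul_right smul_in_carr)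
      also have "\<dots> \<in> P.span B"
        using step closed1[OF that(1) step(1)] by (intro P.span_add P.span_scale) auto
      finally have "pointwise_brac L F (pointwise_smul L c K + H) \<in> P.span B" .
      moreover have "(pointwise_smul L c K + H) z \<in> carr L" for z
        using step vals by (simp add: pointwise_smul_def add_in_carr smul_in_carr)
      ultimately show ?case by (intro conjI allI)
    qed
    then show ?thesis by simp
  qed
  show ?thesis
  \<comment> \<open>The first four goals are the vector space axioms; the others are the subspace
    property and the bracket axioms.\<close>
  proof (unfold_locales, goal_cases)
    case 1
    show ?case by (simp add: pointwise_span_def P.scale_right_distrib)
  next
    case 2
    show ?case by (simp add: pointwise_span_def P.scale_left_distrib)
  next
    case 3
    show ?case by (simp add: pointwise_span_def)
  next
    case 4
    show ?case by (simp add: pointwise_span_def)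
  qed (auto simp: pointwise_span_def closed2[unfolded pointwise_brac_def] val
      pointwise_brac_def fun_eq_iff brac_add_left brac_add_right brac_smul_left brac_smul_right brac_self jacobi pointwise_smul_def
      P.subspace_span)
qed

text \<open>Monomials multiply by adding exponents, so the bracket of two generators is again a
  generator.\<close>

lemma lie_algebra_poly_map_algebra:
  "lie_algebra (poly_map_algebra L :: (complex ^ 'n::finite \<Rightarrow> 'v) lie_struct)"
  unfolding poly_map_algebra_def
proof (rule lie_algebra_pointwise_span)
  interpret P: vector_space "pointwise_smul L :: complex \<Rightarrow> (complex ^ 'n \<Rightarrow> 'v) \<Rightarrow> _"
    by (rule vector_space_pointwise_smul[OF vs])
  let ?B = "{(\<lambda>\<mu> :: complex ^ 'n. smul L (monomial p \<mu>) x) | p x. x \<in> carr L}"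
  show "F z \<in> carr L" if "F \<in> ?B" for F z
    using that by (auto simp: smul_in_carr)
  show "pointwise_brac L F H \<in> P.span ?B" if "F \<in> ?B" "H \<in> ?B" for F H
  proof -
    obtain p q x y where x: "x \<in> carr L" "F = (\<lambda>\<mu>. smul L (monomial p \<mu>) x)"
      and y: "y \<in> carr L" "H = (\<lambda>\<mu>. smul L (monomial q \<mu>) y)"
      using \<open>F \<in> ?B\<close> \<open>H \<in> ?B\<close> by blast
    have "pointwise_brac L F H = (\<lambda>\<mu>. smul L (monomial (p + q) \<mu>) (brac L x y))"
      using x y by (simp add: pointwise_brac_def brac_smul_smul monomial_add)
    then show ?thesis
      using brac_closed[OF x(1) y(1)] by (intro P.span_base) auto
  qed
qed

lemma poly_map_algebra_values:
  "F \<in> carr (poly_map_algebra L) \<Longrightarrow> F z \<in> carr L"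
  unfolding poly_map_algebra_def by (erule pointwise_span_values) (auto simp: smul_in_carr)

section \<open>Bracket and linearity of modes\<close>

lemma mode_in_carr: "t \<in> carr L \<Longrightarrow> mode L t p r z \<in> carr L"
  by (auto simp: mode_def smul_in_carr zero_in_carr split: prod.split)

text \<open>By \<open>mode_affine\<close> the scalars multiply as \<open>p\<close> and
  \<open>r\<close> add; \<open>power_int_add\<close> applies because \<open>l0 / l1\<close> is
  nonzero on the region. Elsewhere both sides are 0. Arbitrary \<open>x\<close> and \<open>y\<close>
  are allowed because the bracket of two basis elements need not be a basis element.\<close>

lemma pointwise_brac_mode:
  assumes "x \<in> carr L" "y \<in> carr L"
  shows "pointwise_brac L (mode L x p r) (mode L y q s) = mode L (brac L x y) (p + q) (r + s)"
  using assms
  by (auto simp: fun_eq_iff pointwise_brac_def mode_affine brac_smul_smul monomial_add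
      power_int_add brac_self zero_in_carr mult_ac)

lemma mode_sum_smul:
  "mode L (\<Sum>c\<in>C. smul L (h c) (t c)) p r = (\<Sum>c\<in>C. pointwise_smul L (h c) (mode L (t c) p r))"
  by (auto simp: fun_eq_iff sum_fun_apply pointwise_smul_def mode_def V.scale_sum_right mult_ac)

section \<open>Closure of the loop algebra under its operations\<close>

lemma loop_algebra_add_closed:
  assumes "F \<in> carr (loop_algebra L)" "H \<in> carr (loop_algebra L)"
  shows "F + H \<in> carr (loop_algebra L)"
proof -
  have "finite {k. (F + H) k \<noteq> 0}"
    by (rule finite_subset[of _ "{k. F k \<noteq> 0} \<union> {k. H k \<noteq> 0}"])
      (use assms in \<open>auto simp: loop_algebra_def\<close>)
  then show ?thesis using assms by (simp add: loop_algebra_def add_in_carr)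
qed

lemma loop_algebra_smul_closed:
  assumes "F \<in> carr (loop_algebra L)"
  shows "smul (loop_algebra L) c F \<in> carr (loop_algebra L)"
proof -
  have "finite {k. smul L c (F k) \<noteq> 0}"
    by (rule finite_subset[of _ "{k. F k \<noteq> 0}"])
      (use assms in \<open>auto simp: loop_algebra_def\<close>)
  then show ?thesis using assms by (simp add: loop_algebra_def smul_in_carr)
qed

text \<open>A nonzero sum has a nonzero term, and a nonzero bracket has two nonzero entries. The
  sumset of two finite supports is finite, which bounds the support of the bracket.\<close>

lemma loop_algebra_brac_support:
  assumes "F \<in> carr (loop_algebra L)" "brac (loop_algebra L) F H n \<noteq> 0"
  shows "n \<in> (\<lambda>(k, l). k + l) ` ({k. F k \<noteq> 0} \<times> {l. H l \<noteq> 0})"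
proof -
  obtain k where k: "F k \<noteq> 0" "brac L (F k) (H (n - k)) \<noteq> 0"
    using assms(2) by (auto simp: loop_algebra_def elim: sum.not_neutral_contains_not_neutral)
  then have "H (n - k) \<noteq> 0"
    using assms(1) brac_zero_right by (auto simp: loop_algebra_def)
  then show ?thesis using k by (force simp: image_iff)
qed

lemma loop_algebra_brac_closed:
  assumes "F \<in> carr (loop_algebra L)" "H \<in> carr (loop_algebra L)"
  shows "brac (loop_algebra L) F H \<in> carr (loop_algebra L)"
proof -
  have "finite {n. brac (loop_algebra L) F H n \<noteq> 0}"
    by (rule finite_subset[of _ "(\<lambda>(k, l). k + l) ` ({k. F k \<noteq> 0} \<times> {l. H l \<noteq> 0})"])
      (use assms loop_algebra_brac_support[OF assms(1)] in \<open>auto simp: loop_algebra_def\<close>)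
  moreover have "brac (loop_algebra L) F H n \<in> carr L" for n
    using assms by (auto simp: loop_algebra_def intro!: sum_in_carr brac_closed)
  ultimately show ?thesis by (simp add: loop_algebra_def)
qed

lemma loop_tensor_in_carr: "a \<in> carr L \<Longrightarrow> loop_tensor a k \<in> carr (loop_algebra L)"
  by (auto simp: loop_algebra_def loop_tensor_def zero_in_carr intro: finite_subset[of _ "{k}"])

end

section \<open>Evaluation of loop algebra elements as functions\<close>

text \<open>The candidate isomorphism in the coordinates \<open>l0 / l1\<close> and
  \<open>\<mu> $ i / l0\<close>. The value 0 off the region matches the extension by zero in
  \<open>mode\<close>.\<close>

definition loop_eval ::
  "'g::ab_group_add lie_struct \<Rightarrow> (int \<Rightarrow> complex ^ 'n::finite \<Rightarrow> 'g)
     \<Rightarrow> (complex ^ 'n) \<times> complex \<times> complex \<Rightarrow> 'g" where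
  "loop_eval G F = (\<lambda>(\<mu>, l0, l1).
     if l0 \<noteq> 0 \<and> l1 \<noteq> 0
     then \<Sum>k | F k \<noteq> 0. smul G ((l0 / l1) powi k) (F k (\<chi> i. \<mu> $ i / l0))
     else 0)"

context lie_algebra
begin

interpretation V: vector_space "smul L" by (rule vs)

text \<open>Terms outside the support vanish, so families with different supports can be summed over
  one common index set.\<close>

lemma loop_eval_superset:
  assumes "finite S" "{k. F k \<noteq> 0} \<subseteq> S" "l0 \<noteq> 0" "l1 \<noteq> 0"
  shows "loop_eval L F (\<mu>, l0, l1)
    = (\<Sum>k\<in>S. smul L ((l0 / l1) powi k) (F k (\<chi> i. \<mu> $ i / l0)))"
  using assms by (auto simp: loop_eval_def intro!: sum.mono_neutral_left)

lemma loop_eval_add: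
  assumes "finite {k. F k \<noteq> 0}" "finite {k. H k \<noteq> 0}"
  shows "loop_eval L (F + H) = loop_eval L F + loop_eval L H"
proof -
  let ?S = "{k. F k \<noteq> 0} \<union> {k. H k \<noteq> 0}"
  have "loop_eval L (F + H) (\<mu>, l0, l1)
      = loop_eval L F (\<mu>, l0, l1) + loop_eval L H (\<mu>, l0, l1)" for \<mu> l0 l1
  proof (cases "l0 \<noteq> 0 \<and> l1 \<noteq> 0")
    case True
    have "{k. (F + H) k \<noteq> 0} \<subseteq> ?S" by auto
    with True assms show ?thesis
      by (subst (1 2 3) loop_eval_superset[where S = ?S])
        (auto simp: V.scale_right_distrib sum.distrib)
  qed (auto simp: loop_eval_def)
  then show ?thesis by (auto simp: fun_eq_iff)
qed

lemma loop_eval_smul: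
  assumes "finite {k. F k \<noteq> 0}"
  shows "loop_eval L (\<lambda>k. pointwise_smul L c (F k)) = pointwise_smul L c (loop_eval L F)"
proof -
  let ?S = "{k. F k \<noteq> 0}"
  have "loop_eval L (\<lambda>k. pointwise_smul L c (F k)) (\<mu>, l0, l1)
      = smul L c (loop_eval L F (\<mu>, l0, l1))" for \<mu> l0 l1
  proof (cases "l0 \<noteq> 0 \<and> l1 \<noteq> 0")
    case True
    have "{k. pointwise_smul L c (F k) \<noteq> 0} \<subseteq> ?S" by (auto simp: pointwise_smul_def fun_eq_iff)
    with True assms show ?thesis
      by (subst (1 2) loop_eval_superset[where S = ?S])
        (auto simp: V.scale_sum_right pointwise_smul_def mult_ac)
  qed (auto simp: loop_eval_def)
  then show ?thesis by (auto simp: fun_eq_iff pointwise_smul_def)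
qed

text \<open>The loop bracket is a convolution of coefficients, and evaluation turns convolution into
  multiplication because \<open>t powi (k + l) = t powi k * t powi l\<close>.\<close>

lemma loop_eval_brac:
  assumes F: "F \<in> carr (loop_algebra (poly_map_algebra L))"
    and H: "H \<in> carr (loop_algebra (poly_map_algebra L))"
  shows "loop_eval L (brac (loop_algebra (poly_map_algebra L)) F H)
    = pointwise_brac L (loop_eval L F) (loop_eval L H)"
proof -
  interpret P: lie_algebra "poly_map_algebra L :: (complex ^ 'b \<Rightarrow> 'v) lie_struct"
    by (rule lie_algebra_poly_map_algebra)
  define S where "S = {k. F k \<noteq> 0}"
  define R where "R = {l. H l \<noteq> 0}"
  \<comment> \<open>\<open>N\<close> contains every degree that the bracket can reach, and does not
    depend on \<open>k\<close>; this makes the exchange of sums possible.\<close>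
  define N where "N = (\<lambda>(k, l). k + l) ` (S \<times> R)"
  have fin: "finite S" "finite R" "finite N"
    using F H by (auto simp: loop_algebra_def S_def R_def N_def)
  have val: "F k z \<in> carr L" "H k z \<in> carr L" for k z
    using F H by (auto simp: loop_algebra_def poly_map_algebra_values)
  have "loop_eval L (brac (loop_algebra (poly_map_algebra L)) F H) (\<mu>, l0, l1)
      = brac L (loop_eval L F (\<mu>, l0, l1)) (loop_eval L H (\<mu>, l0, l1))" for \<mu> l0 l1
  proof (cases "l0 \<noteq> 0 \<and> l1 \<noteq> 0")
    case True
    define t where "t = l0 / l1"
    define z where "z = (\<chi> i. \<mu> $ i / l0)"
    have t0: "t \<noteq> 0" using True by (simp add: t_def)
    \<comment> \<open>For fixed \<open>k\<close> only the degrees \<open>n = k + l\<close> with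
      \<open>l \<in> R\<close> contribute; substituting \<open>l = n - k\<close> separates the two
      factors.\<close>
    have shift: "(\<Sum>n\<in>N. smul L (t powi n) (brac L (F k z) (H (n - k) z)))
        = (\<Sum>l\<in>R. smul L (t powi (k + l)) (brac L (F k z) (H l z)))" if "k \<in> S" for k
    proof -
      have "(\<Sum>n\<in>N. smul L (t powi n) (brac L (F k z) (H (n - k) z)))
          = (\<Sum>n\<in>(+) k ` R. smul L (t powi n) (brac L (F k z) (H (n - k) z)))"
      proof (rule sum.mono_neutral_right)
        show "\<forall>n\<in>N - (+) k ` R. smul L (t powi n) (brac L (F k z) (H (n - k) z)) = 0"
        proof
          fix n assume n: "n \<in> N - (+) k ` R"
          have "n - k \<notin> R"
          proof
            assume "n - k \<in> R"
            then have "k + (n - k) \<in> (+) k ` R" by (rule imageI)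
            then show False using n by simp
          qed
          then have "H (n - k) = 0" by (simp add: R_def)
          then show "smul L (t powi n) (brac L (F k z) (H (n - k) z)) = 0"
            using val by (simp add: brac_zero_right)
        qed
      qed (use fin that in \<open>auto simp: N_def\<close>)
      then show ?thesis by (simp add: sum.reindex)
    qed
    have "loop_eval L (brac (loop_algebra (poly_map_algebra L)) F H) (\<mu>, l0, l1)
        = (\<Sum>n\<in>N. smul L (t powi n) (brac (loop_algebra (poly_map_algebra L)) F H n z))"
      unfolding t_def z_def using True fin P.loop_algebra_brac_support[OF F]
      by (intro loop_eval_superset) (auto simp: N_def S_def R_def)
    also have "\<dots> = (\<Sum>n\<in>N. \<Sum>k\<in>S. smul L (t powi n) (brac L (F k z) (H (n - k) z)))"
      by (simp add: loop_algebra_def poly_map_algebra_def pointwise_span_def sum_fun_apply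
          pointwise_brac_def V.scale_sum_right S_def)
    also have "\<dots> = (\<Sum>k\<in>S. \<Sum>n\<in>N. smul L (t powi n) (brac L (F k z) (H (n - k) z)))"
      by (rule sum.swap)
    also have "\<dots> = (\<Sum>k\<in>S. \<Sum>l\<in>R. smul L (t powi (k + l)) (brac L (F k z) (H l z)))"
      by (simp add: shift)
    also have "\<dots> = brac L (\<Sum>k\<in>S. smul L (t powi k) (F k z)) (\<Sum>l\<in>R. smul L (t powi l) (H l z))"
      using val t0
      by (subst sum.swap)
        (simp add: brac_sum_left brac_sum_right sum_in_carr smul_in_carr brac_smul_smul
          power_int_add)
    also have "\<dots> = brac L (loop_eval L F (\<mu>, l0, l1)) (loop_eval L H (\<mu>, l0, l1))"
      using True by (simp add: loop_eval_def S_def R_def t_def z_def)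
    finally show ?thesis .
  qed (auto simp: loop_eval_def brac_self zero_in_carr)
  then show ?thesis by (auto simp: fun_eq_iff pointwise_brac_def)
qed

text \<open>For a fixed affine point \<open>z\<close> the value is a Laurent polynomial in
  \<open>t\<close> with coefficients \<open>F k z\<close>. This yields injectivity.\<close>

lemma loop_eval_eq_0D:
  assumes "finite {k. F k \<noteq> 0}" "loop_eval L F = 0"
  shows "F = 0"
proof -
  have "F k z = 0" if "F k \<noteq> 0" for k z
  proof (rule laurent_coefficients_zero[OF vs assms(1)])
    fix t :: complex
    assume "t \<noteq> 0"
    \<comment> \<open>The point is chosen to have affine coordinates \<open>z\<close> and
      \<open>t\<close>: here \<open>l0 = t\<close> and \<open>l1 = 1\<close>.\<close>
    then have "(\<Sum>k | F k \<noteq> 0. smul L (t powi k) (F k z)) = loop_eval L F (\<chi> i. t * z $ i, t, 1)"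
      by (simp add: loop_eval_def)
    then show "(\<Sum>k | F k \<noteq> 0. smul L (t powi k) (F k z)) = 0"
      by (simp add: assms(2))
  qed (use that in simp)
  then show ?thesis by (auto simp: fun_eq_iff)
qed

lemma loop_eval_tensor:
  "loop_eval L (loop_tensor a k) (\<mu>, l0, l1)
    = (if l0 \<noteq> 0 \<and> l1 \<noteq> 0 then smul L ((l0 / l1) powi k) (a (\<chi> i. \<mu> $ i / l0)) else 0)"
proof (cases "l0 \<noteq> 0 \<and> l1 \<noteq> 0")
  case True
  then show ?thesis
    \<comment> \<open>The singleton also covers \<open>a = 0\<close>, where the support is
      empty.\<close>
    by (subst loop_eval_superset[where S = "{k}"]) (auto simp: loop_tensor_def)
qed (auto simp: loop_eval_def)

text \<open>Matches the generators on both sides, by \<open>mode_affine\<close>; the image of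
  \<open>loop_eval\<close> is computed from this.\<close>

lemma loop_eval_tensor_monomial:
  "loop_eval L (loop_tensor (\<lambda>\<mu>. smul L (monomial p \<mu>) x) r) = mode L x p r"
  by (auto simp: fun_eq_iff loop_eval_tensor mode_affine mult_ac)

end

section \<open>The Lie algebra spanned by the modes\<close>

lemma lie_basis_in_carr:
  assumes "lie_algebra G" "lie_basis G A T" "a \<in> A"
  shows "T a \<in> carr G"
proof -
  interpret V: vector_space "smul G" by (rule lie_algebra.vs[OF assms(1)])
  have "T a \<in> V.span (T ` A)" using assms(3) by (intro V.span_base) simp
  then show ?thesis using assms(2) by (simp add: lie_basis_def)
qed

text \<open>A mode is linear in its Lie algebra element, so \<open>x\<close> may be expanded in the
  basis. Brackets of basis elements and coefficients of polynomial maps are general elements of this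
  kind.\<close>

lemma mode_in_mode_algebra:
  fixes G :: "'g::ab_group_add lie_struct" and p :: "nat ^ 'n::finite"
  assumes "lie_algebra G" "lie_basis G A T" "x \<in> carr G"
  shows "mode G x p r \<in> carr (mode_algebra G A T)"
proof -
  interpret V: vector_space "smul G" by (rule lie_algebra.vs[OF assms(1)])
  interpret P: vector_space "pointwise_smul G ::
      complex \<Rightarrow> ((complex ^ 'n) \<times> complex \<times> complex \<Rightarrow> 'g) \<Rightarrow> _"
    by (rule vector_space_pointwise_smul[OF V.vector_space_axioms])
  have "x \<in> V.span (T ` A)" using assms by (simp add: lie_basis_def)
  then show ?thesis
    unfolding mode_algebra_def pointwise_span_def lie_struct.simps
  proof (induction rule: V.span_induct_alt)
    case base
    have "mode G 0 p r = 0" by (auto simp: fun_eq_iff mode_def)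
    then have "mode G 0 p r \<in> P.span {mode G (T a) p r | a p r. a \<in> A}"
      by (simp only: P.span_zero)
    then show ?case .
  next
    case (step c x y)
    have "mode G (smul G c x + y) p r = pointwise_smul G c (mode G x p r) + mode G y p r"
      by (auto simp: fun_eq_iff mode_def pointwise_smul_def V.scale_right_distrib mult_ac)
    also have "\<dots> \<in> P.span {mode G (T a) p r | a p r. a \<in> A}"
      using step(1) by (intro P.span_add P.span_scale P.span_base[of "mode G x p r"] step(2)) auto
    finally show ?case .
  qed
qed

lemma lie_algebra_mode_algebra:
  fixes G :: "'g::ab_group_add lie_struct"
  assumes "lie_algebra G" "lie_basis G A T"
  shows "lie_algebra
    (mode_algebra G A T :: ((complex ^ 'n::finite) \<times> complex \<times> complex \<Rightarrow> 'g) lie_struct)"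
proof -
  interpret lie_algebra G by fact
  have T: "T a \<in> carr G" if "a \<in> A" for a
    using lie_basis_in_carr[OF assms that] .
  have "pointwise_brac G (mode G (T a) p r) (mode G (T b) q s) \<in> carr (mode_algebra G A T)"
    if "a \<in> A" "b \<in> A" for a b r s and p q :: "nat ^ 'n"
    using that by (simp add: pointwise_brac_mode T mode_in_mode_algebra[OF assms] brac_closed)
  then have closed: "pointwise_brac G F H \<in> module.span (pointwise_smul G)
        {mode G (T a) p r | a p r. a \<in> A}"
    if "F \<in> {mode G (T a) p r | a p r. a \<in> A}" "H \<in> {mode G (T a) p r | a p r. a \<in> A}"
    for F H :: "(complex ^ 'n) \<times> complex \<times> complex \<Rightarrow> 'g"
    using that unfolding mode_algebra_def pointwise_span_def by fastforce
  show ?thesis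
    unfolding mode_algebra_def
  proof (rule lie_algebra_pointwise_span)
    show "F z \<in> carr G" if "F \<in> {mode G (T a) p r | a p r. a \<in> A}"
      for F :: "(complex ^ 'n) \<times> complex \<times> complex \<Rightarrow> 'g" and z
      using that T mode_in_carr by blast
  qed (rule closed)
qed

section \<open>The isomorphism with the loop algebra\<close>

text \<open>By linearity both inclusions reduce to generators: monomial tensors go to modes, and
  every generating mode is the value of such a tensor.\<close>

lemma loop_eval_image:
  fixes G :: "'g::ab_group_add lie_struct"
  assumes "lie_algebra G" "lie_basis G A T"
  shows "loop_eval G ` carr (loop_algebra (poly_map_algebra G))
    = carr (mode_algebra G A T :: ((complex ^ 'n::finite) \<times> complex \<times> complex \<Rightarrow> _) lie_struct)"
    (is "_ ` ?C = ?M")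
proof -
  interpret lie_algebra G by fact
  interpret V: vector_space "smul G" by (rule vs)
  interpret Q: vector_space "pointwise_smul G :: complex \<Rightarrow> (complex ^ 'n \<Rightarrow> 'g) \<Rightarrow> _"
    by (rule vector_space_pointwise_smul[OF vs])
  interpret P: vector_space "pointwise_smul G ::
      complex \<Rightarrow> ((complex ^ 'n) \<times> complex \<times> complex \<Rightarrow> 'g) \<Rightarrow> _"
    by (rule vector_space_pointwise_smul[OF vs])
  interpret W: lie_algebra "poly_map_algebra G :: (complex ^ 'n \<Rightarrow> 'g) lie_struct"
    by (rule lie_algebra_poly_map_algebra)
  have M: "?M = P.span {mode G (T a) p r | a p r. a \<in> A}"
    by (simp add: mode_algebra_def pointwise_span_def)
  have fin: "finite {k. F k \<noteq> 0}" if "F \<in> ?C" for F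
    using that by (simp add: loop_algebra_def)
  have zero_C: "0 \<in> ?C"
    using W.zero_in_carr by (simp add: loop_algebra_def func_zero)
  have eval_0: "loop_eval G (0 :: int \<Rightarrow> complex ^ 'n \<Rightarrow> 'g) = 0"
    by (auto simp: fun_eq_iff loop_eval_def)
  have tensor: "loop_eval G (loop_tensor a k) \<in> ?M" if "a \<in> carr (poly_map_algebra G)" for a k
    using that unfolding poly_map_algebra_def pointwise_span_def lie_struct.simps
  proof (induction rule: Q.span_induct_alt)
    case base
    have "loop_eval G (loop_tensor (0 :: complex ^ 'n \<Rightarrow> 'g) k) = 0"
      by (auto simp: fun_eq_iff loop_eval_tensor)
    then have "loop_eval G (loop_tensor (0 :: complex ^ 'n \<Rightarrow> 'g) k) \<in> ?M"
      by (simp only: M P.span_zero)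
    then show ?case .
  next
    case (step c x y)
    have "loop_eval G (loop_tensor (pointwise_smul G c x + y) k)
        = pointwise_smul G c (loop_eval G (loop_tensor x k)) + loop_eval G (loop_tensor y k)"
      by (auto simp: fun_eq_iff loop_eval_tensor pointwise_smul_def V.scale_right_distrib mult_ac)
    also have "\<dots> \<in> ?M"
    proof -
      have "loop_eval G (loop_tensor x k) \<in> ?M"
        using step(1) mode_in_mode_algebra[OF assms] by (auto simp: loop_eval_tensor_monomial)
      then show ?thesis
        using step(2) unfolding M by (intro P.span_add P.span_scale)
    qed
    finally show ?case .
  qed
  \<comment> \<open>Membership in \<open>?C\<close> is carried along because
    \<open>loop_eval_add\<close> requires the partial sum to have finite support.\<close>
  have tensor_sum: "loop_eval G (\<Sum>k\<in>S. loop_tensor (F k) k) \<in> ?M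
      \<and> (\<Sum>k\<in>S. loop_tensor (F k) k) \<in> ?C"
    if "F \<in> ?C" "finite S" for F S
    using that(2)
  proof (induction S rule: finite_induct)
    case empty
    show ?case using eval_0 zero_C by (simp only: sum.empty M P.span_zero simp_thms)
  next
    case (insert j S)
    have "F j \<in> carr (poly_map_algebra G)" using that(1) by (simp add: loop_algebra_def)
    then have "loop_tensor (F j) j \<in> ?C" "loop_eval G (loop_tensor (F j) j) \<in> ?M"
      using W.loop_tensor_in_carr tensor by auto
    note j = this
    let ?F = "\<Sum>k\<in>S. loop_tensor (F k) k"
    have S: "?F \<in> ?C" "loop_eval G ?F \<in> ?M" using insert.IH by auto
    have "loop_eval G (loop_tensor (F j) j + ?F) \<in> ?M"
      using j S unfolding loop_eval_add[OF fin[OF j(1)] fin[OF S(1)]] M by (intro P.span_add)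
    moreover have "loop_tensor (F j) j + ?F \<in> ?C"
      using j(1) S(1) by (rule W.loop_algebra_add_closed)
    ultimately show ?case
      unfolding sum.insert[OF insert.hyps] by (rule conjI)
  qed
  have "loop_eval G F \<in> ?M" if "F \<in> ?C" for F
    using tensor_sum[OF that fin[OF that]] loop_algebra_carr_tensor_sum[OF that] by simp
  moreover have "?M \<subseteq> loop_eval G ` ?C"
    unfolding M
  \<comment> \<open>The image is a subspace, so it contains the span once it contains the generating
    modes.\<close>
  proof (rule P.span_minimal)
    show "{mode G (T a) p r | a p r. a \<in> A} \<subseteq> loop_eval G ` ?C"
    proof clarify
      fix a r and p :: "nat ^ 'n"
      assume "a \<in> A"
      then have "(\<lambda>\<mu>. smul G (monomial p \<mu>) (T a)) \<in> carr (poly_map_algebra G)"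
        using lie_basis_in_carr[OF assms]
        by (auto simp: poly_map_algebra_def pointwise_span_def intro!: Q.span_base)
      from imageI[OF W.loop_tensor_in_carr[OF this], of "loop_eval G" r]
      show "mode G (T a) p r \<in> loop_eval G ` ?C"
        by (simp only: loop_eval_tensor_monomial)
    qed
    have "0 \<in> loop_eval G ` ?C"
      using imageI[OF zero_C, of "loop_eval G"] by (simp only: eval_0)
    moreover have "loop_eval G F + loop_eval G H \<in> loop_eval G ` ?C"
      if "F \<in> ?C" "H \<in> ?C" for F H
      using imageI[OF W.loop_algebra_add_closed[OF that], of "loop_eval G"]
      by (simp only: loop_eval_add[OF fin[OF that(1)] fin[OF that(2)]])
    moreover have "pointwise_smul G c (loop_eval G F) \<in> loop_eval G ` ?C"
      if "F \<in> ?C" for F c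
    proof -
      have "(\<lambda>k. pointwise_smul G c (F k)) \<in> ?C"
        using W.loop_algebra_smul_closed[OF that, of c]
        by (simp add: loop_algebra_def poly_map_algebra_def pointwise_span_def)
      from imageI[OF this, of "loop_eval G"] show ?thesis
        by (simp only: loop_eval_smul[OF fin[OF that]])
    qed
    ultimately show "P.subspace (loop_eval G ` ?C)"
      unfolding P.subspace_def by blast
  qed
  ultimately show ?thesis by blast
qed

lemma lie_isomorphism_loop_eval:
  fixes G :: "'g::ab_group_add lie_struct"
  assumes "lie_algebra G" "lie_basis G A T"
  shows "lie_isomorphism (loop_algebra (poly_map_algebra G)) (mode_algebra G A T)
    (loop_eval G :: _ \<Rightarrow> (complex ^ 'n::finite) \<times> complex \<times> complex \<Rightarrow> _)"
proof -
  interpret lie_algebra G by fact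
  interpret W: lie_algebra "poly_map_algebra G :: (complex ^ 'n \<Rightarrow> 'g) lie_struct"
    by (rule lie_algebra_poly_map_algebra)
  interpret V: vector_space "smul G" by (rule vs)
  interpret P: vector_space "pointwise_smul G ::
      complex \<Rightarrow> ((complex ^ 'n) \<times> complex \<times> complex \<Rightarrow> 'g) \<Rightarrow> _"
    by (rule vector_space_pointwise_smul[OF vs])
  let ?C = "carr (loop_algebra (poly_map_algebra G :: (complex ^ 'n \<Rightarrow> 'g) lie_struct))"
  let ?M = "mode_algebra G A T :: ((complex ^ 'n) \<times> complex \<times> complex \<Rightarrow> 'g) lie_struct"
  have fin: "finite {k. F k \<noteq> 0}" if "F \<in> ?C" for F
    using that by (simp add: loop_algebra_def)
  have smul: "loop_eval G (smul (loop_algebra (poly_map_algebra G)) c F)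
      = pointwise_smul G c (loop_eval G F)" if "F \<in> ?C" for c F
    using loop_eval_smul[OF fin[OF that]]
    by (simp add: loop_algebra_def poly_map_algebra_def pointwise_span_def)
  have "inj_on (loop_eval G) ?C"
  proof (rule inj_onI)
    fix F H assume *: "F \<in> ?C" "H \<in> ?C" "loop_eval G F = loop_eval G H"
    \<comment> \<open>Writing \<open>- H\<close> as a scalar multiple lets closure under scaling and
      addition put the difference \<open>F + ?H\<close> into \<open>?C\<close>, where the kernel is
      trivial.\<close>
    let ?H = "smul (loop_algebra (poly_map_algebra G)) (-1) H"
    have "?H \<in> ?C" using *(2) by (rule W.loop_algebra_smul_closed)
    then have "F + ?H \<in> ?C" "loop_eval G (F + ?H) = 0"
      using * by (auto simp: W.loop_algebra_add_closed loop_eval_add fin smul)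
    then have "F + ?H = 0" using loop_eval_eq_0D fin by blast
    moreover have "?H = - H"
      by (simp add: loop_algebra_def poly_map_algebra_def pointwise_span_def
          pointwise_smul_def fun_eq_iff V.scale_minus_left)
    ultimately show "F = H" by simp
  qed
  then have bij: "bij_betw (loop_eval G) ?C (carr ?M)"
    by (simp only: bij_betw_def loop_eval_image[OF assms] simp_thms)
  have M: "smul ?M = pointwise_smul G" "brac ?M = pointwise_brac G"
    by (simp_all add: mode_algebra_def pointwise_span_def)
  show ?thesis
    unfolding lie_isomorphism_def M
  proof (intro conjI ballI allI bij)
    fix F H assume FH: "F \<in> ?C" "H \<in> ?C"
    show "loop_eval G (F + H) = loop_eval G F + loop_eval G H"
      by (rule loop_eval_add[OF fin[OF FH(1)] fin[OF FH(2)]])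
    show "loop_eval G (brac (loop_algebra (poly_map_algebra G)) F H)
        = pointwise_brac G (loop_eval G F) (loop_eval G H)"
      using FH by (rule loop_eval_brac)
  qed (rule smul)
qed

theorem mainTheorem2:
  fixes m :: nat
    and G :: "'g::ab_group_add lie_struct"
    and A :: "'a set" and T :: "'a \<Rightarrow> 'g"
    and f :: "'a \<Rightarrow> 'a \<Rightarrow> 'a \<Rightarrow> complex"
  assumes "m \<ge> 1"
    and "CARD('n::finite) = 2 * m"
    and "lie_algebra G"
    and "finite A"
    and "lie_basis G A T"
    and "\<forall>a\<in>A. \<forall>b\<in>A. brac G (T a) (T b) = (\<Sum>c\<in>A. smul G (f a b c) (T c))"
  shows "(\<forall>a\<in>A. \<forall>b\<in>A. \<forall>(p :: nat ^ 'n) (q :: nat ^ 'n) (r :: int) (s :: int).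
            pointwise_brac G (mode G (T a) p r) (mode G (T b) q s)
              = (\<Sum>c\<in>A. pointwise_smul G (f a b c) (mode G (T c) (p + q) (r + s))))
       \<and> lie_algebra
            (mode_algebra G A T :: ((complex ^ 'n) \<times> complex \<times> complex \<Rightarrow> 'g) lie_struct)
       \<and> lie_isomorphic
            (mode_algebra G A T :: ((complex ^ 'n) \<times> complex \<times> complex \<Rightarrow> 'g) lie_struct)
            (loop_algebra (poly_map_algebra G :: (complex ^ 'n \<Rightarrow> 'g) lie_struct))"
proof (intro conjI ballI allI)
  interpret lie_algebra G by fact
  interpret W: lie_algebra "poly_map_algebra G :: (complex ^ 'n \<Rightarrow> 'g) lie_struct"
    by (rule lie_algebra_poly_map_algebra)
  show "lie_algebra
      (mode_algebra G A T :: ((complex ^ 'n) \<times> complex \<times> complex \<Rightarrow> 'g) lie_struct)"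
    using assms(3,5) by (rule lie_algebra_mode_algebra)
  show "lie_isomorphic
      (mode_algebra G A T :: ((complex ^ 'n) \<times> complex \<times> complex \<Rightarrow> 'g) lie_struct)
      (loop_algebra (poly_map_algebra G :: (complex ^ 'n \<Rightarrow> 'g) lie_struct))"
    \<comment> \<open>\<open>loop_eval\<close> runs from the loop algebra to the modes; its inverse
      is the isomorphism sought.\<close>
    by (rule lie_isomorphic_inverse[OF lie_isomorphism_loop_eval[OF assms(3,5)]])
      (simp_all add: W.loop_algebra_add_closed W.loop_algebra_smul_closed
        W.loop_algebra_brac_closed)
  fix a b and p q :: "nat ^ 'n" and r s
  assume "a \<in> A" "b \<in> A"
  \<comment> \<open>The bracket is the mode of \<open>brac G (T a) (T b)\<close>, which the
    structure constants expand by linearity.\<close>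
  then show "pointwise_brac G (mode G (T a) p r) (mode G (T b) q s)
      = (\<Sum>c\<in>A. pointwise_smul G (f a b c) (mode G (T c) (p + q) (r + s)))"
    using assms(6) lie_basis_in_carr[OF assms(3,5)]
    by (simp add: pointwise_brac_mode mode_sum_smul)
qed

end
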